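(* Let $(d_1,d_2,d_3)$ be an $\varepsilon$-hyper relative differential operator on a Lie algebra $\mathfrak g$ with respect to a representation $(V;\rho)$, and let $N_k=d_{k-1}^{-1}\circ d_{k+1}$ for $k\in\mathbb Z_3$. Then $(d_i,N_k)$ is a DN-structure on $\mathfrak g$ with respect to $(V;\rho)$ for all $i,k\in\mathbb Z_3$ with $i\neq k$.
   Context: Everything is over a ground field $\mathbb K$. Let $\mathfrak g$ be a Lie algebra and $\rho:\mathfrak g\to\mathfrak{gl}(V)$ a representation, denoted $(V;\rho)$. A relative differential operator (with respect to $(V;\rho)$) is a linear map $d:\mathfrak g\to V$ with $d[x,y]=\rho(x)d(y)-\rho(y)d(x)$ for all $x,y\in\mathfrak g$. A Nijenhuis operator on $\mathfrak g$ is a linear map $N:\mathfrak g\to\mathfrak g$ with $[N(x),N(y)]=N\big([N(x),y]+[x,N(y)]-N[x,y]\big)$ for all $x,y\in\mathfrak g$. Indices are in $\mathbb Z_3=\{1,2,3\}$ (mod 3). Let $d_1,d_2,d_3:\mathfrak g\to V$ be invertible relative differential operators with respect to $(V;\rho)$; set $T_i:=d_i^{-1}$ and $N_i:=T_{i-1}\circ d_{i+1}$. If $N_i^2=\varepsilon_i\,\mathrm{Id}_{\mathfrak g}$ with $\varepsilon_i\in\{1,-1\}$ for $i=1,2,3$, the triple $(d_1,d_2,d_3)$ is called an $\varepsilon=(\varepsilon_1,\varepsilon_2,\varepsilon_3)$-hyper relative differential operator. A DN-structure on $\mathfrak g$ with respect to $(V;\rho)$ is a pair $(d,N)$, where $d$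 is a relative differential operator with respect to $(V;\rho)$ and $N$ is a Nijenhuis operator on $\mathfrak g$, such that $d\circ N$ is also a relative differential operator with respect to $(V;\rho)$. *)

theory Defs
  imports Complex_Main "HOL-Library.Numeral_Type"
begin

locale lie_algebra = vector_space scale
  for scale :: "'k::field \<Rightarrow> 'g::ab_group_add \<Rightarrow> 'g" +
  fixes bracket :: "'g \<Rightarrow> 'g \<Rightarrow> 'g"
  assumes linear_bracket_right: "\<And>x. Vector_Spaces.linear scale scale (\<lambda>y. bracket x y)"
    and linear_bracket_left: "\<And>y. Vector_Spaces.linear scale scale (\<lambda>x. bracket x y)"
    and bracket_self: "\<And>x. bracket x x = 0"
    and jacobi: "\<And>x y z.
      bracket x (bracket y z) + bracket y (bracket z x) + bracket z (bracket x y) = 0"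

text \<open>
  The codomain \<open>gl(V)\<close> is rendered by functions \<open>'v \<Rightarrow> 'v\<close> that are linear, with the
  pointwise vector space structure and the commutator bracket.
\<close>

locale lie_representation =
  lie_algebra scaleG bracket + V: vector_space scaleV
  for scaleG :: "'k::field \<Rightarrow> 'g::ab_group_add \<Rightarrow> 'g"
    and bracket :: "'g \<Rightarrow> 'g \<Rightarrow> 'g"
    and scaleV :: "'k \<Rightarrow> 'v::ab_group_add \<Rightarrow> 'v" +
  fixes \<rho> :: "'g \<Rightarrow> 'v \<Rightarrow> 'v"
  assumes rho_endomorphism: "\<And>x. Vector_Spaces.linear scaleV scaleV (\<rho> x)"
    and rho_linear: "\<And>v. Vector_Spaces.linear scaleG scaleV (\<lambda>x. \<rho> x v)"
    and rho_bracket: "\<And>x y v. \<rho> (bracket x y) v = \<rho> x (\<rho> y v) - \<rho> y (\<rho> x v)"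

definition relative_differential_operator ::
  "('k::field \<Rightarrow> 'g::ab_group_add \<Rightarrow> 'g) \<Rightarrow> ('g \<Rightarrow> 'g \<Rightarrow> 'g) \<Rightarrow>
   ('k \<Rightarrow> 'v::ab_group_add \<Rightarrow> 'v) \<Rightarrow> ('g \<Rightarrow> 'v \<Rightarrow> 'v) \<Rightarrow> ('g \<Rightarrow> 'v) \<Rightarrow> bool"
  where "relative_differential_operator scaleG bracket scaleV \<rho> d \<longleftrightarrow>
    Vector_Spaces.linear scaleG scaleV d \<and>
    (\<forall>x y. d (bracket x y) = \<rho> x (d y) - \<rho> y (d x))"

definition nijenhuis_operator ::
  "('k::field \<Rightarrow> 'g::ab_group_add \<Rightarrow> 'g) \<Rightarrow> ('g \<Rightarrow> 'g \<Rightarrow> 'g) \<Rightarrow> ('g \<Rightarrow> 'g) \<Rightarrow> bool"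
  where "nijenhuis_operator scaleG bracket N \<longleftrightarrow>
    Vector_Spaces.linear scaleG scaleG N \<and>
    (\<forall>x y. bracket (N x) (N y) =
      N (bracket (N x) y + bracket x (N y) - N (bracket x y)))"

definition DN_structure ::
  "('k::field \<Rightarrow> 'g::ab_group_add \<Rightarrow> 'g) \<Rightarrow> ('g \<Rightarrow> 'g \<Rightarrow> 'g) \<Rightarrow>
   ('k \<Rightarrow> 'v::ab_group_add \<Rightarrow> 'v) \<Rightarrow> ('g \<Rightarrow> 'v \<Rightarrow> 'v) \<Rightarrow> ('g \<Rightarrow> 'v) \<Rightarrow> ('g \<Rightarrow> 'g) \<Rightarrow> bool"
  where "DN_structure scaleG bracket scaleV \<rho> d N \<longleftrightarrow>
    relative_differential_operator scaleG bracket scaleV \<rho> d \<and>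
    nijenhuis_operator scaleG bracket N \<and>
    relative_differential_operator scaleG bracket scaleV \<rho> (d \<circ> N)"

text \<open>
  A triple indexed by \<open>\<int>/3\<int>\<close> is a function on the numeral type \<open>3\<close>, whose arithmetic is
  modulo 3 and whose elements are \<open>1\<close>, \<open>2\<close> and \<open>3 = 0\<close>.
\<close>

definition hyper_N :: "(3 \<Rightarrow> 'g \<Rightarrow> 'v) \<Rightarrow> 3 \<Rightarrow> 'g \<Rightarrow> 'g"
  where "hyper_N d i = inv (d (i - 1)) \<circ> d (i + 1)"

definition hyper_relative_differential_operator ::
  "('k::field \<Rightarrow> 'g::ab_group_add \<Rightarrow> 'g) \<Rightarrow> ('g \<Rightarrow> 'g \<Rightarrow> 'g) \<Rightarrow>
   ('k \<Rightarrow> 'v::ab_group_add \<Rightarrow> 'v) \<Rightarrow> ('g \<Rightarrow> 'v \<Rightarrow> 'v) \<Rightarrow>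
   (3 \<Rightarrow> 'k) \<Rightarrow> (3 \<Rightarrow> 'g \<Rightarrow> 'v) \<Rightarrow> bool"
  where "hyper_relative_differential_operator scaleG bracket scaleV \<rho> \<epsilon> d \<longleftrightarrow>
    (\<forall>i. relative_differential_operator scaleG bracket scaleV \<rho> (d i) \<and> bij (d i)) \<and>
    (\<forall>i. \<epsilon> i \<in> {1, - 1} \<and> (\<forall>x. hyper_N d i (hyper_N d i x) = scaleG (\<epsilon> i) x))"

end

theory Submission
  imports Defs
begin

text \<open>
  Write \<open>N = N\<^sub>k\<close>. By definition \<open>d\<^sub>k\<^sub>-\<^sub>1 \<circ> N = d\<^sub>k\<^sub>+\<^sub>1\<close>, and \<open>N\<^sup>2 = \<epsilon>\<^sub>k Id\<close> gives
  \<open>d\<^sub>k\<^sub>+\<^sub>1 \<circ> N = \<epsilon>\<^sub>k d\<^sub>k\<^sub>-\<^sub>1\<close>. So precomposition with \<open>N\<close> exchanges, up to a scalar, the two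
  relative differential operators whose index differs from \<open>k\<close>, and it remains to see that \<open>N\<close>
  is a Nijenhuis operator. This follows from lemma \<open>nijenhuis_operatorI\<close>: if \<open>d\<close> is injective
  and all of \<open>d\<close>, \<open>d \<circ> N\<close>, \<open>d \<circ> N\<^sup>2\<close> are relative differential operators, then the
  identities for these three operators add up to the Nijenhuis identity seen through \<open>d\<close>. It is
  applied to \<open>d = d\<^sub>k\<^sub>-\<^sub>1\<close>, for which the three operators are \<open>d\<^sub>k\<^sub>-\<^sub>1\<close>, \<open>d\<^sub>k\<^sub>+\<^sub>1\<close> and
  \<open>\<epsilon>\<^sub>k d\<^sub>k\<^sub>-\<^sub>1\<close>.
\<close>

lemma linear_if_comp_inj_linear:
  assumes "Vector_Spaces.linear s1 s3 (f \<circ> g)" "Vector_Spaces.linear s2 s3 f" "inj f"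
  shows "Vector_Spaces.linear s1 s2 g"
proof -
  interpret fg: Vector_Spaces.linear s1 s3 "f \<circ> g" by (fact assms(1))
  interpret f: Vector_Spaces.linear s2 s3 f by (fact assms(2))
  show ?thesis
  proof unfold_locales
    show "g (x + y) = g x + g y" for x y
      using fg.add[of x y] by (intro injD[OF assms(3)]) (simp add: f.add)
    show "g (s1 c x) = s2 c (g x)" for c x
      using fg.scale[of c x] by (intro injD[OF assms(3)]) (simp add: f.scale)
  qed
qed

context lie_representation
begin

abbreviation rel_diff_op :: "('g \<Rightarrow> 'v) \<Rightarrow> bool"
  where "rel_diff_op \<equiv> relative_differential_operator scaleG bracket scaleV \<rho>"

lemma rel_diff_op_scale:
  assumes "rel_diff_op d"
  shows "rel_diff_op (\<lambda>x. scaleV c (d x))"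
proof -
  interpret d: Vector_Spaces.linear scaleG scaleV d
    using assms by (simp add: relative_differential_operator_def)
  interpret r: Vector_Spaces.linear scaleV scaleV "\<rho> x" for x by (fact rho_endomorphism)
  have "Vector_Spaces.linear scaleG scaleV (\<lambda>x. scaleV c (d x))"
    by unfold_locales
      (simp_all add: d.add d.scale V.scale_right_distrib V.scale_scale mult.commute)
  then show ?thesis
    using assms
    by (simp add: relative_differential_operator_def r.scale V.scale_right_diff_distrib)
qed

text \<open>
  Expand \<open>d [Nx, Ny]\<close>, \<open>dN [Nx, y]\<close> and \<open>dN [x, Ny]\<close>. The terms in \<open>\<rho> (Nx)\<close> and
  \<open>\<rho> (Ny)\<close> cancel in the sum of the last two minus the first; what is left is
  \<open>\<rho> x (dN\<^sup>2 y) - \<rho> y (dN\<^sup>2 x)\<close>, which is \<open>dN\<^sup>2 [x, y]\<close>.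
\<close>
lemma nijenhuis_operatorI:
  assumes d: "rel_diff_op d" "rel_diff_op (d \<circ> N)" "rel_diff_op (d \<circ> N \<circ> N)"
    and inj: "inj d"
  shows "nijenhuis_operator scaleG bracket N"
proof -
  interpret d: Vector_Spaces.linear scaleG scaleV d
    using d(1) by (simp add: relative_differential_operator_def)
  have "Vector_Spaces.linear scaleG scaleG N"
    using d(1,2) inj
    by (auto simp: relative_differential_operator_def intro: linear_if_comp_inj_linear)
  then interpret N: Vector_Spaces.linear scaleG scaleG N .
  have "bracket (N x) (N y) = N (bracket (N x) y + bracket x (N y) - N (bracket x y))" for x y
  proof (rule injD[OF inj])
    have
      "d (bracket (N x) (N y)) = \<rho> (N x) (d (N y)) - \<rho> (N y) (d (N x))"
      "d (N (bracket (N x) y)) = \<rho> (N x) (d (N y)) - \<rho> y (d (N (N x)))"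
      "d (N (bracket x (N y))) = \<rho> x (d (N (N y))) - \<rho> (N y) (d (N x))"
      "d (N (N (bracket x y))) = \<rho> x (d (N (N y))) - \<rho> y (d (N (N x)))"
      using d by (simp_all add: relative_differential_operator_def)
    then show "d (bracket (N x) (N y))
        = d (N (bracket (N x) y + bracket x (N y) - N (bracket x y)))"
      by (simp add: N.add N.diff d.add d.diff)
  qed
  then show ?thesis
    using N.linear_axioms by (simp add: nijenhuis_operator_def)
qed

lemma hyper_DN_structure:
  assumes hyper: "hyper_relative_differential_operator scaleG bracket scaleV \<rho> \<epsilon> d"
    and i: "i = k - 1 \<or> i = k + 1"
  shows "DN_structure scaleG bracket scaleV \<rho> (d i) (hyper_N d k)"
proof -
  let ?N = "hyper_N d k"
  have rel: "rel_diff_op (d j)" and bij: "bij (d j)" for j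
    using hyper by (auto simp: hyper_relative_differential_operator_def)
  have N_sq: "?N (?N x) = scaleG (\<epsilon> k) x" for x
    using hyper by (simp add: hyper_relative_differential_operator_def)
  have minus_N: "d (k - 1) \<circ> ?N = d (k + 1)"
    using bij[of "k - 1"] by (simp add: fun_eq_iff hyper_N_def bij_is_surj surj_f_inv_f)
  interpret d: Vector_Spaces.linear scaleG scaleV "d (k - 1)"
    using rel[of "k - 1"] by (simp add: relative_differential_operator_def)
  have plus_N: "d (k + 1) \<circ> ?N = (\<lambda>x. scaleV (\<epsilon> k) (d (k - 1) x))"
    by (simp add: fun_eq_iff minus_N[symmetric] N_sq d.scale)
  have "rel_diff_op (d (k + 1) \<circ> ?N)"
    using rel_diff_op_scale[OF rel] by (simp add: plus_N)
  moreover from this have "nijenhuis_operator scaleG bracket ?N"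
    using rel bij[of "k - 1"]
    by (intro nijenhuis_operatorI[of "d (k - 1)"]) (simp_all add: minus_N bij_is_inj)
  ultimately show ?thesis
    using i rel minus_N by (auto simp: DN_structure_def)
qed

end

lemma neq_imp_neighbour_3:
  fixes i k :: 3
  assumes "i \<noteq> k"
  shows "i = k - 1 \<or> i = k + 1"
proof -
  have "j = 0 \<or> j = 1 \<or> j = 2" for j :: 3
  proof (induct j)
    case (of_int z)
    then have "z = 0 \<or> z = 1 \<or> z = 2" by auto
    then show ?case by auto
  qed
  from this[of "i - k"] show ?thesis
  proof (elim disjE)
    assume "i - k = 2"
    also have "(2 :: 3) = - 1" by simp
    finally show ?thesis by (simp add: algebra_simps)
  qed (use assms in \<open>simp_all add: algebra_simps\<close>)
qed

theorem theorem3p6: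
  fixes scaleG :: "'k::field \<Rightarrow> 'g::ab_group_add \<Rightarrow> 'g"
    and bracket :: "'g \<Rightarrow> 'g \<Rightarrow> 'g"
    and scaleV :: "'k \<Rightarrow> 'v::ab_group_add \<Rightarrow> 'v"
    and \<rho> :: "'g \<Rightarrow> 'v \<Rightarrow> 'v"
    and \<epsilon> :: "3 \<Rightarrow> 'k"
    and d :: "3 \<Rightarrow> 'g \<Rightarrow> 'v"
  assumes "lie_representation scaleG bracket scaleV \<rho>"
    and "hyper_relative_differential_operator scaleG bracket scaleV \<rho> \<epsilon> d"
  shows "\<forall>i k. i \<noteq> k \<longrightarrow> DN_structure scaleG bracket scaleV \<rho> (d i) (hyper_N d k)"
  using lie_representation.hyper_DN_structure[OF assms] neq_imp_neighbour_3 by blast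

end
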